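(* Let $\alpha>0$, $n>0$, $\kappa>0$, $\theta_0\in\mathbb{R}$, $c_0=e^{\alpha\theta_0}$, and $\sigma_s(t)=\frac{1}{\alpha t+c_0}$. Consider solutions $(\bar u,\bar\theta)(x,t)$, for $x\in[0,1]$ and $t\ge0$, of $$ \bar u_t=\sigma_s(t)\,\big(n\bar u_{xx}-\alpha\bar\theta_{xx}\big),\qquad \bar\theta_t-\kappa\bar\theta_{xx}=\sigma_s(t)\,\big((n+1)\bar u-\alpha\bar\theta\big), $$ with boundary conditions $\bar u_x(0,t)=\bar u_x(1,t)=0$ and $\bar\theta_x(0,t)=\bar\theta_x(1,t)=0$, that satisfy $\int_0^1\bar u(x,t)\,dx=0$ for all $t\ge 0$. Then there exist $A>0$ and $T>0$ such that $$ \int_0^1\Big(\tfrac A2\bar u^2+\tfrac12\bar\theta^2\Big)(x,t)\,dx\le\int_0^1\Big(\tfrac A2\bar u^2+\tfrac12\bar\theta^2\Big)(x,T)\,dx\qquad\text{for } t\ge T, $$ and $$ \int_0^1\Big(\tfrac A2\bar u^2+\tfrac12\bar\theta^2\Big)(x,t)\,dx\to0\qquad\text{as } t\to\infty . $$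
   Context: Subscripts $t$ and $x$ denote partial derivatives. Solutions are understood to be classical (sufficiently smooth on $[0,1]\times[0,\infty)$). The constants $A$ and $T$ depend only on the parameters $\alpha,n,\kappa,c_0$ and not on the particular solution. *)

theory Defs
  imports "HOL-Analysis.Analysis"
begin

text \<open>
  A function \<open>f\<close> of \<open>(x, t)\<close> with \<open>0 \<le> x \<le> 1\<close> and \<open>0 \<le> t\<close> is curried as \<open>f x t\<close>. Its partial
  derivatives are taken within the domain, hence are one-sided at \<open>x = 0\<close>, \<open>x = 1\<close> and \<open>t = 0\<close>.
\<close>

definition partial_x :: "(real \<Rightarrow> real \<Rightarrow> real) \<Rightarrow> real \<Rightarrow> real \<Rightarrow> real" where
  "partial_x f x t = vector_derivative (\<lambda>y. f y t) (at x within {0..1})"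

definition partial_t :: "(real \<Rightarrow> real \<Rightarrow> real) \<Rightarrow> real \<Rightarrow> real \<Rightarrow> real" where
  "partial_t f x t = vector_derivative (\<lambda>s. f x s) (at t within {0..})"

abbreviation partial_xx :: "(real \<Rightarrow> real \<Rightarrow> real) \<Rightarrow> real \<Rightarrow> real \<Rightarrow> real" where
  "partial_xx f \<equiv> partial_x (partial_x f)"

definition jointly_continuous :: "(real \<Rightarrow> real \<Rightarrow> real) \<Rightarrow> bool" where
  "jointly_continuous f \<longleftrightarrow> continuous_on ({0..1} \<times> {0..}) (\<lambda>(x, t). f x t)"

text \<open>
  Class \<open>C\<^sup>2\<^sup>,\<^sup>1\<close> up to the boundary of \<open>[0,1] \<times> [0,\<infinity>)\<close>: the regularity that makes every term of a
  second-order parabolic equation classical. Differentiability is required separately because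
  \<^const>\<open>vector_derivative\<close> is total.
\<close>

definition C21 :: "(real \<Rightarrow> real \<Rightarrow> real) \<Rightarrow> bool" where
  "C21 f \<longleftrightarrow>
     (\<forall>t\<ge>0. (\<lambda>x. f x t) differentiable_on {0..1}) \<and>
     (\<forall>t\<ge>0. (\<lambda>x. partial_x f x t) differentiable_on {0..1}) \<and>
     (\<forall>x\<in>{0..1}. (\<lambda>t. f x t) differentiable_on {0..}) \<and>
     jointly_continuous f \<and>
     jointly_continuous (partial_x f) \<and>
     jointly_continuous (partial_xx f) \<and>
     jointly_continuous (partial_t f)"

definition sigma_s :: "real \<Rightarrow> real \<Rightarrow> real \<Rightarrow> real" where
  "sigma_s \<alpha> c0 t = 1 / (\<alpha> * t + c0)"

definition neumann_bc :: "(real \<Rightarrow> real \<Rightarrow> real) \<Rightarrow> bool" where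
  "neumann_bc f \<longleftrightarrow> (\<forall>t\<ge>0. partial_x f 0 t = 0 \<and> partial_x f 1 t = 0)"

definition classical_solution ::
  "real \<Rightarrow> real \<Rightarrow> real \<Rightarrow> real \<Rightarrow> (real \<Rightarrow> real \<Rightarrow> real) \<Rightarrow> (real \<Rightarrow> real \<Rightarrow> real) \<Rightarrow> bool" where
  "classical_solution \<alpha> n \<kappa> c0 u \<theta> \<longleftrightarrow>
     C21 u \<and> C21 \<theta> \<and>
     (\<forall>x\<in>{0..1}. \<forall>t\<ge>0.
        partial_t u x t = sigma_s \<alpha> c0 t * (n * partial_xx u x t - \<alpha> * partial_xx \<theta> x t)) \<and>
     (\<forall>x\<in>{0..1}. \<forall>t\<ge>0.
        partial_t \<theta> x t - \<kappa> * partial_xx \<theta> x t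
          = sigma_s \<alpha> c0 t * ((n + 1) * u x t - \<alpha> * \<theta> x t)) \<and>
     neumann_bc u \<and> neumann_bc \<theta>"

definition energy :: "real \<Rightarrow> (real \<Rightarrow> real \<Rightarrow> real) \<Rightarrow> (real \<Rightarrow> real \<Rightarrow> real) \<Rightarrow> real \<Rightarrow> real" where
  "energy A u \<theta> t = integral {0..1} (\<lambda>x. A / 2 * (u x t)\<^sup>2 + 1 / 2 * (\<theta> x t)\<^sup>2)"

end

theory Submission
  imports Defs "HOL-Real_Asymp.Real_Asymp"
begin

text \<open>
  Integrating by parts, the energy \<open>E\<close> with weight \<open>A\<close> satisfies
  \<open>E' = \<sigma> A (- n \<integral>u\<^sub>x\<^sup>2 + \<alpha> \<integral>u\<^sub>x \<theta>\<^sub>x) - \<kappa> \<integral>\<theta>\<^sub>x\<^sup>2 + \<sigma> ((n + 1) \<integral>u \<theta> - \<alpha> \<integral>\<theta>\<^sup>2)\<close>.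
  Young's inequality and the Poincare inequality for the mean-zero function \<open>u\<close> absorb \<open>\<integral>u \<theta>\<close>
  once \<open>A\<close> is large, and \<open>\<integral>u\<^sub>x \<theta>\<^sub>x\<close> once \<open>\<sigma> A\<close> is small compared with \<open>\<kappa>\<close>, which holds for late
  times. What remains is \<open>E' \<le> - c \<sigma> E\<close> with \<open>c = min n \<alpha>\<close>, so that \<open>E (\<alpha> t + c\<^sub>0) powr (c / \<alpha>)\<close> is
  nonincreasing; since \<open>\<sigma>\<close> is not integrable in time, \<open>E\<close> tends to zero.
\<close>

section \<open>Integral inequalities of Young, Cauchy-Schwarz and Poincare type\<close>

lemma integral_young:
  fixes f g :: "real \<Rightarrow> real"
  assumes f: "continuous_on {a..b} f" and g: "continuous_on {a..b} g" and e: "e > 0"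
  shows "integral {a..b} (\<lambda>x. f x * g x)
    \<le> e * integral {a..b} (\<lambda>x. (f x)\<^sup>2) + 1 / (4 * e) * integral {a..b} (\<lambda>x. (g x)\<^sup>2)"
proof -
  have "integral {a..b} (\<lambda>x. f x * g x)
    \<le> integral {a..b} (\<lambda>x. e * (f x)\<^sup>2 + 1 / (4 * e) * (g x)\<^sup>2)"
  proof (intro integral_le integrable_continuous_interval continuous_intros f g)
    fix x
    have "0 \<le> (2 * e * f x - g x)\<^sup>2 / (4 * e)" using e by simp
    also have "\<dots> = e * (f x)\<^sup>2 + 1 / (4 * e) * (g x)\<^sup>2 - f x * g x"
      using e by (simp add: field_simps power2_eq_square)
    finally show "f x * g x \<le> e * (f x)\<^sup>2 + 1 / (4 * e) * (g x)\<^sup>2" by simp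
  qed
  also have "\<dots> = e * integral {a..b} (\<lambda>x. (f x)\<^sup>2) + 1 / (4 * e) * integral {a..b} (\<lambda>x. (g x)\<^sup>2)"
    using e
    by (subst integral_add)
       (auto intro!: integrable_continuous_interval continuous_intros f g)
  finally show ?thesis .
qed

text \<open>The variance of \<open>\<bar>v\<bar>\<close> is nonnegative: with \<open>m\<close> its
  mean, integrate \<open>(\<bar>v x\<bar> - m)\<^sup>2\<close>. The interval has length 1, so the
  constant \<open>m\<^sup>2\<close> integrates to itself.\<close>

lemma square_integral_abs_le:
  fixes v :: "real \<Rightarrow> real"
  assumes v: "continuous_on {0..1} v"
  shows "(integral {0..1} (\<lambda>x. \<bar>v x\<bar>))\<^sup>2 \<le> integral {0..1} (\<lambda>x. (v x)\<^sup>2)"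
proof -
  define m where "m = integral {0..1} (\<lambda>x. \<bar>v x\<bar>)"
  have "0 \<le> integral {0..1} (\<lambda>x. (\<bar>v x\<bar> - m)\<^sup>2)"
    by (intro integral_nonneg integrable_continuous_interval continuous_intros v) auto
  also have "\<dots> = integral {0..1} (\<lambda>x. (v x)\<^sup>2 - 2 * m * \<bar>v x\<bar> + m\<^sup>2)"
    by (simp add: power2_diff algebra_simps)
  also have "\<dots> = integral {0..1} (\<lambda>x. (v x)\<^sup>2) - 2 * m * m + m\<^sup>2"
    by (subst integral_add integral_diff,
        (auto intro!: integrable_continuous_interval continuous_intros v)[2])+
       (simp add: m_def)
  finally show ?thesis by (simp add: m_def power2_eq_square)
qed

text \<open>Rolle's theorem applies to the antiderivative of \<open>f\<close> from \<open>a\<close>,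
  which vanishes at both endpoints.\<close>

lemma continuous_integral_zero_imp_root:
  fixes f :: "real \<Rightarrow> real"
  assumes f: "continuous_on {a..b} f" and ab: "a < b" and zero: "integral {a..b} f = 0"
  obtains z where "z \<in> {a..b}" "f z = 0"
proof -
  have "continuous_on {a..b} (\<lambda>y. integral {a..y} f)"
    by (intro indefinite_integral_continuous_1 integrable_continuous_interval f)
  moreover have "((\<lambda>y. integral {a..y} f) has_real_derivative f x) (at x)" if "a < x" "x < b" for x
    using integral_has_real_derivative[OF f, of x] that
    by (metis atLeastAtMost_iff at_within_Icc_at less_imp_le)
  \<comment> \<open>Rolle's theorem is used with derivatives as linear maps: multiplication by
    \<open>f z\<close> is the zero map, and evaluating it at 1 gives \<open>f z = 0\<close>.\<close>
  ultimately obtain z where "a < z" "z < b" "(\<lambda>y. 0) = (*) (f z)"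
    using Rolle_deriv[of a b "\<lambda>y. integral {a..y} f" "\<lambda>x. (*) (f x)"] ab zero
    by (auto simp: has_field_derivative_def)
  then show ?thesis by (intro that[of z]) (auto dest: fun_cong[of _ _ 1])
qed

text \<open>A mean-zero \<open>f\<close> has a root \<open>z\<close>, and the variation of
  \<open>f\<close> between \<open>z\<close> and any point is at most the integral of
  \<open>\<bar>f'\<bar>\<close>. This bounds \<open>f\<close> pointwise, giving the constant 1
  rather than the sharp one, which is enough here.\<close>

lemma poincare:
  fixes f f' :: "real \<Rightarrow> real"
  assumes der: "\<And>x. x \<in> {0..1} \<Longrightarrow> (f has_vector_derivative f' x) (at x within {0..1})"
    and f': "continuous_on {0..1} f'" and zero: "integral {0..1} f = 0"
  shows "integral {0..1} (\<lambda>x. (f x)\<^sup>2) \<le> integral {0..1} (\<lambda>x. (f' x)\<^sup>2)"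
proof -
  let ?V = "integral {0..1} (\<lambda>x. (f' x)\<^sup>2)"
  have f: "continuous_on {0..1} f"
    using der by (meson continuous_on_eq_continuous_within has_vector_derivative_continuous)
  obtain z where z: "z \<in> {0..1}" "f z = 0"
    using continuous_integral_zero_imp_root[OF f _ zero] by auto
  have osc: "\<bar>f q - f p\<bar> \<le> integral {0..1} (\<lambda>x. \<bar>f' x\<bar>)" if "0 \<le> p" "p \<le> q" "q \<le> 1" for p q
  proof -
    have sub: "{p..q} \<subseteq> {0..1}" using that by auto
    have "(f' has_integral f q - f p) {p..q}"
      using that sub
      by (intro fundamental_theorem_of_calculus)
         (auto intro!: has_vector_derivative_within_subset[OF der])
    then have "\<bar>f q - f p\<bar> = \<bar>integral {p..q} f'\<bar>" by (simp add: integral_unique)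
    also have "\<dots> \<le> integral {p..q} (\<lambda>x. \<bar>f' x\<bar>)"
      using integral_norm_bound_integral[of f' "{p..q}" "\<lambda>x. \<bar>f' x\<bar>"]
      by (auto intro!: integrable_continuous_interval continuous_intros
            continuous_on_subset[OF f' sub])
    also have "\<dots> \<le> integral {0..1} (\<lambda>x. \<bar>f' x\<bar>)"
      by (intro integral_subset_le sub integrable_continuous_interval continuous_intros f'
            continuous_on_subset[OF f' sub]) auto
    finally show ?thesis .
  qed
  have "(f x)\<^sup>2 \<le> ?V" if "x \<in> {0..1}" for x
  proof -
    have "\<bar>f x\<bar> \<le> integral {0..1} (\<lambda>x. \<bar>f' x\<bar>)"
      using osc[of x z] osc[of z x] z that by (cases "x \<le> z") auto
    then have "(f x)\<^sup>2 \<le> (integral {0..1} (\<lambda>x. \<bar>f' x\<bar>))\<^sup>2"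
      by (metis abs_ge_zero power2_abs power_mono)
    then show ?thesis using square_integral_abs_le[OF f'] by simp
  qed
  then have "integral {0..1} (\<lambda>x. (f x)\<^sup>2) \<le> integral {0..1} (\<lambda>x::real. ?V)"
    by - (rule integral_le, auto intro!: integrable_continuous_interval continuous_intros f)
  then show ?thesis by simp
qed

section \<open>Partial derivatives, time slices and integration by parts for \<open>C21\<close>
  functions\<close>

lemma C21_has_partial_derivatives:
  assumes "C21 f" "x \<in> {0..1}" "t \<ge> 0"
  shows has_partial_x: "((\<lambda>y. f y t) has_vector_derivative partial_x f x t) (at x within {0..1})"
    and has_partial_xx:
      "((\<lambda>y. partial_x f y t) has_vector_derivative partial_xx f x t) (at x within {0..1})"
    and has_partial_t: "((\<lambda>s. f x s) has_vector_derivative partial_t f x t) (at t within {0..})"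
  using assms
  by (auto simp: C21_def partial_x_def[of f x] partial_x_def[of "partial_x f" x] partial_t_def
      differentiable_on_def vector_derivative_works[symmetric])

lemma jointly_continuous_slice:
  assumes "jointly_continuous f" "t \<ge> 0"
  shows "continuous_on {0..1} (\<lambda>x. f x t)"
proof -
  have "continuous_on {0..1} ((\<lambda>(x, t). f x t) \<circ> (\<lambda>x. (x, t)))"
    using assms unfolding jointly_continuous_def
    by (intro continuous_on_compose continuous_intros) (auto elim!: continuous_on_subset)
  then show ?thesis by (simp add: o_def)
qed

lemma C21_slices:
  assumes "C21 f" "t \<ge> 0"
  shows "continuous_on {0..1} (\<lambda>x. f x t)" "continuous_on {0..1} (\<lambda>x. partial_x f x t)"
    "continuous_on {0..1} (\<lambda>x. partial_xx f x t)" "continuous_on {0..1} (\<lambda>x. partial_t f x t)"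
  using assms by (auto simp: C21_def intro: jointly_continuous_slice)

text \<open>Integrate the derivative of \<open>f * partial_x g\<close> over the interval; the
  boundary terms carry the factor \<open>partial_x g\<close>, which vanishes at 0 and 1.\<close>

lemma integral_mult_partial_xx:
  assumes f: "C21 f" and g: "C21 g" and bc: "neumann_bc g" and t: "t \<ge> 0"
  shows "integral {0..1} (\<lambda>x. f x t * partial_xx g x t)
    = - integral {0..1} (\<lambda>x. partial_x f x t * partial_x g x t)"
proof -
  note [continuous_intros] = C21_slices[OF f t] C21_slices[OF g t]
  have "((\<lambda>x. f x t * partial_xx g x t + partial_x f x t * partial_x g x t)
     has_integral f 1 t * partial_x g 1 t - f 0 t * partial_x g 0 t) {0..1}"
    by (intro fundamental_theorem_of_calculus has_vector_derivative_mult
          has_partial_x has_partial_xx f g t) auto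
  then have "integral {0..1} (\<lambda>x. f x t * partial_xx g x t + partial_x f x t * partial_x g x t) = 0"
    using bc t by (simp add: neumann_bc_def integral_unique)
  then show ?thesis
    by (subst (asm) integral_add)
       (auto intro!: integrable_continuous_interval continuous_intros)
qed

section \<open>Time derivative and dissipation of the energy\<close>

lemma energy_has_derivative:
  assumes u: "C21 u" and \<theta>: "C21 \<theta>" and t: "t > 0"
  shows "(energy A u \<theta> has_real_derivative
    integral {0..1} (\<lambda>x. A * (u x t * partial_t u x t) + \<theta> x t * partial_t \<theta> x t)) (at t)"
proof -
  \<comment> \<open>The Leibniz rule puts the parameter, here time, before the integration variable,
    opposite to the order in \<open>jointly_continuous\<close>.\<close>
  have swap: "continuous_on ({0..} \<times> {0..1}) (\<lambda>z. f (snd z) (fst z))"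
    if "jointly_continuous f" for f :: "real \<Rightarrow> real \<Rightarrow> real"
  proof -
    have "continuous_on ({0..} \<times> {0..1}) ((\<lambda>(x, t). f x t) \<circ> prod.swap)"
      using that unfolding jointly_continuous_def
      by (intro continuous_on_compose continuous_on_swap) (auto simp: product_swap)
    then show ?thesis by (simp add: o_def prod.swap_def)
  qed
  have jc: "jointly_continuous u" "jointly_continuous \<theta>"
    "jointly_continuous (partial_t u)" "jointly_continuous (partial_t \<theta>)"
    using u \<theta> by (auto simp: C21_def)
  have "((\<lambda>s. integral (cbox 0 1) (\<lambda>x. A / 2 * (u x s)\<^sup>2 + 1 / 2 * (\<theta> x s)\<^sup>2))
    has_real_derivative
    integral (cbox 0 1) (\<lambda>x. A * (u x t * partial_t u x t) + \<theta> x t * partial_t \<theta> x t))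
    (at t within {0..})"
  proof (rule leibniz_rule_field_derivative)
    fix s x :: real assume s: "s \<in> {0..}" and x: "x \<in> cbox 0 1"
    have "((\<lambda>s. u x s) has_real_derivative partial_t u x s) (at s within {0..})"
      "((\<lambda>s. \<theta> x s) has_real_derivative partial_t \<theta> x s) (at s within {0..})"
      using has_partial_t[OF u, of x s] has_partial_t[OF \<theta>, of x s] s x
      by (auto simp: has_real_derivative_iff_has_vector_derivative)
    then show "((\<lambda>s. A / 2 * (u x s)\<^sup>2 + 1 / 2 * (\<theta> x s)\<^sup>2) has_real_derivative
      A * (u x s * partial_t u x s) + \<theta> x s * partial_t \<theta> x s) (at s within {0..})"
      by (auto intro!: derivative_eq_intros)
  next
    fix s :: real assume "s \<in> {0..}"
    then show "(\<lambda>x. A / 2 * (u x s)\<^sup>2 + 1 / 2 * (\<theta> x s)\<^sup>2) integrable_on cbox 0 1"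
      using C21_slices[OF u, of s] C21_slices[OF \<theta>, of s]
      by (auto intro!: integrable_continuous_interval continuous_intros)
  next
    show "continuous_on ({0..} \<times> cbox 0 1)
      (\<lambda>(s, x). A * (u x s * partial_t u x s) + \<theta> x s * partial_t \<theta> x s)"
      unfolding split_beta cbox_interval by (intro continuous_intros swap jc)
  qed (use t in auto)
  \<comment> \<open>Since \<open>t > 0\<close> is interior, the derivative within the half-line is
    two-sided.\<close>
  moreover have "at t within {0..} = at t" using t by (intro at_within_interior) auto
  ultimately show ?thesis by (simp add: energy_def[abs_def])
qed

lemma energy_eq:
  assumes u: "C21 u" and \<theta>: "C21 \<theta>" and t: "t \<ge> 0"
  shows "energy A u \<theta> t
    = A / 2 * integral {0..1} (\<lambda>x. (u x t)\<^sup>2) + 1 / 2 * integral {0..1} (\<lambda>x. (\<theta> x t)\<^sup>2)"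
  unfolding energy_def using C21_slices[OF u t] C21_slices[OF \<theta> t]
  by (subst integral_add) (auto intro!: integrable_continuous_interval continuous_intros)

text \<open>The budget: of the dissipation \<open>A * s * n * V\<close>, a quarter pays for
  \<open>P\<close>, a quarter pays for \<open>R\<close> through Poincare, and half remains. Of
  \<open>s * \<alpha> * S\<close>, half pays for \<open>R\<close> and half remains. All of
  \<open>\<kappa> * Q\<close> is reserved for \<open>P\<close>.\<close>

lemma energy_dissipation:
  assumes pos: "\<alpha> > 0" "n > 0" "\<kappa> > 0" "A > 0" and c0: "c0 > 0" and t: "t > 0"
    and sol: "classical_solution \<alpha> n \<kappa> c0 u \<theta>" and mean: "integral {0..1} (\<lambda>x. u x t) = 0"
    and A: "2 * (n + 1)\<^sup>2 \<le> A * n * \<alpha>"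
    and late: "A * \<alpha>\<^sup>2 * sigma_s \<alpha> c0 t \<le> n * \<kappa>"
  obtains D where "(energy A u \<theta> has_real_derivative D) (at t)"
    and "D \<le> - (min n \<alpha> * sigma_s \<alpha> c0 t * energy A u \<theta> t)"
proof -
  let ?I = "\<lambda>f. integral {0..1} f"
  define s where "s = sigma_s \<alpha> c0 t"
  define U where "U = ?I (\<lambda>x. (u x t)\<^sup>2)"
  define V where "V = ?I (\<lambda>x. (partial_x u x t)\<^sup>2)"
  define P where "P = ?I (\<lambda>x. partial_x u x t * partial_x \<theta> x t)"
  define Q where "Q = ?I (\<lambda>x. (partial_x \<theta> x t)\<^sup>2)"
  define R where "R = ?I (\<lambda>x. u x t * \<theta> x t)"
  define S where "S = ?I (\<lambda>x. (\<theta> x t)\<^sup>2)"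
  define D where "D = ?I (\<lambda>x. A * (u x t * partial_t u x t) + \<theta> x t * partial_t \<theta> x t)"
  have u: "C21 u" and \<theta>: "C21 \<theta>" and bc: "neumann_bc u" "neumann_bc \<theta>"
    using sol by (auto simp: classical_solution_def)
  have t0: "t \<ge> 0" using t by simp
  note cont = C21_slices[OF u t0] C21_slices[OF \<theta> t0]
  have s: "s > 0" using pos c0 t by (simp add: s_def sigma_s_def add_pos_pos)
  have D: "D = - (A * s * n * V) + A * s * \<alpha> * P - \<kappa> * Q + s * (n + 1) * R - s * \<alpha> * S"
  proof -
    have "A * (u x t * partial_t u x t) + \<theta> x t * partial_t \<theta> x t
      = A * s * n * (u x t * partial_xx u x t) - A * s * \<alpha> * (u x t * partial_xx \<theta> x t)
        + \<kappa> * (\<theta> x t * partial_xx \<theta> x t)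
        + s * (n + 1) * (u x t * \<theta> x t) - s * \<alpha> * (\<theta> x t)\<^sup>2" if "x \<in> {0..1}" for x
    proof -
      have "partial_t u x t = s * (n * partial_xx u x t - \<alpha> * partial_xx \<theta> x t)"
        and "partial_t \<theta> x t = \<kappa> * partial_xx \<theta> x t + s * ((n + 1) * u x t - \<alpha> * \<theta> x t)"
        using sol that t0 by (auto simp: classical_solution_def s_def algebra_simps)
      then show ?thesis by (simp only:) (simp add: algebra_simps power2_eq_square)
    qed
    then have "D = ?I (\<lambda>x. A * s * n * (u x t * partial_xx u x t)
      - A * s * \<alpha> * (u x t * partial_xx \<theta> x t) + \<kappa> * (\<theta> x t * partial_xx \<theta> x t)
        + s * (n + 1) * (u x t * \<theta> x t) - s * \<alpha> * (\<theta> x t)\<^sup>2)"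
      unfolding D_def by (intro integral_cong) auto
    also have "\<dots> = A * s * n * ?I (\<lambda>x. u x t * partial_xx u x t)
      - A * s * \<alpha> * ?I (\<lambda>x. u x t * partial_xx \<theta> x t) + \<kappa> * ?I (\<lambda>x. \<theta> x t * partial_xx \<theta> x t)
        + s * (n + 1) * R - s * \<alpha> * S"
      unfolding R_def S_def integral_mult_right[symmetric]
      by (intro integral_unique has_integral_add has_integral_diff integrable_integral
            integrable_continuous_interval continuous_intros cont)
    finally show ?thesis
      by (simp add: integral_mult_partial_xx u \<theta> bc t0 P_def V_def Q_def power2_eq_square)
  qed
  have UV: "U \<le> V" unfolding U_def V_def
    by (rule poincare) (use has_partial_x[OF u _ t0] cont mean in auto)
  \<comment> \<open>The Young weight makes \<open>A * s * \<alpha> * P\<close> cost exactly a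
    quarter of \<open>A * s * n * V\<close>.\<close>
  have PVQ: "P \<le> n / (4 * \<alpha>) * V + \<alpha> / n * Q"
    using integral_young[OF cont(2,6), of "n / (4 * \<alpha>)"] pos
    by (simp add: P_def V_def Q_def)
  \<comment> \<open>The Young weight makes the \<open>S\<close> share of
    \<open>s * (n + 1) * R\<close> exactly half of \<open>s * \<alpha> * S\<close>.\<close>
  have RUS: "R \<le> (n + 1) / (2 * \<alpha>) * U + \<alpha> / (2 * (n + 1)) * S"
  proof -
    have "1 / (4 * ((n + 1) / (2 * \<alpha>))) = \<alpha> / (2 * (n + 1))"
      using pos by (simp add: field_simps)
    then show ?thesis
      using integral_young[OF cont(1,5), of "(n + 1) / (2 * \<alpha>)"] pos
      by (simp only: R_def U_def S_def) simp
  qed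
  have nn: "U \<ge> 0" "Q \<ge> 0" "S \<ge> 0"
    unfolding U_def Q_def S_def
    by (auto intro!: integral_nonneg integrable_continuous_interval continuous_intros cont)
  have "A * s * \<alpha> * P \<le> A * s * \<alpha> * (n / (4 * \<alpha>) * V + \<alpha> / n * Q)"
    using PVQ pos s by (intro mult_left_mono) auto
  also have "\<dots> = A * s * n / 4 * V + A * \<alpha>\<^sup>2 * s / n * Q"
    using pos by (simp add: field_simps power2_eq_square)
  \<comment> \<open>Here lateness enters: \<open>late\<close> bounds the coefficient of
    \<open>Q\<close> by \<open>\<kappa>\<close>.\<close>
  also have "A * \<alpha>\<^sup>2 * s / n * Q \<le> \<kappa> * Q"
    using late pos nn by (intro mult_right_mono) (auto simp: s_def field_simps)
  finally have 1: "A * s * \<alpha> * P \<le> A * s * n / 4 * V + \<kappa> * Q" by simp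
  have "s * (n + 1) * R \<le> s * (n + 1) * ((n + 1) / (2 * \<alpha>) * U + \<alpha> / (2 * (n + 1)) * S)"
    using RUS pos s by (intro mult_left_mono) auto
  also have "\<dots> = s * ((n + 1)\<^sup>2 / (2 * \<alpha>)) * U + s * \<alpha> / 2 * S"
  proof -
    have "s * m * (m / (2 * \<alpha>) * U + \<alpha> / (2 * m) * S) = s * (m\<^sup>2 / (2 * \<alpha>)) * U + s * \<alpha> / 2 * S"
      if "m > 0" for m
      using that pos by (simp add: field_simps power2_eq_square)
    from this[of "n + 1"] show ?thesis using pos by simp
  qed
  \<comment> \<open>The largeness of \<open>A\<close> is exactly
    \<open>(n + 1)\<^sup>2 / (2 * \<alpha>) \<le> A * n / 4\<close>.\<close>
  also have "s * ((n + 1)\<^sup>2 / (2 * \<alpha>)) * U \<le> s * (A * n / 4) * U"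
    using A pos nn s by (intro mult_right_mono mult_left_mono) (auto simp: field_simps)
  finally have 2: "s * (n + 1) * R \<le> A * s * n / 4 * U + s * \<alpha> / 2 * S"
    by (simp add: mult_ac)
  have "A * s * n / 4 * U \<le> A * s * n / 4 * V" "A * s * n * U \<le> A * s * n * V"
    using UV pos s by (auto intro!: mult_left_mono)
  with 1 2 have "D \<le> - (A * s * n / 2 * U + s * \<alpha> / 2 * S)"
    unfolding D by simp
  also have "\<dots> = - (n * (s * (A / 2 * U)) + \<alpha> * (s * (1 / 2 * S)))"
    by (simp add: mult_ac)
  \<comment> \<open>The \<open>u\<close> part of the energy decays at rate \<open>n * s\<close> and
    the \<open>\<theta>\<close> part at rate \<open>\<alpha> * s\<close>; the minimum serves
    both.\<close>
  also have "\<dots> \<le> - (min n \<alpha> * (s * (A / 2 * U)) + min n \<alpha> * (s * (1 / 2 * S)))"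
    using nn pos s by (intro le_imp_neg_le add_mono mult_right_mono) auto
  also have "\<dots> = - (min n \<alpha> * s * energy A u \<theta> t)"
    by (simp add: energy_eq[OF u \<theta> t0] U_def S_def algebra_simps)
  finally show ?thesis
    using that energy_has_derivative[OF u \<theta> t, of A] by (simp add: D_def s_def)
qed

section \<open>Choice of the constants and decay of the energy\<close>

theorem lemma3p2:
  fixes \<alpha> n \<kappa> \<theta>0 c0 :: real
  assumes "\<alpha> > 0" and "n > 0" and "\<kappa> > 0"
    and "c0 = exp (\<alpha> * \<theta>0)"
  shows "\<exists>A>0. \<exists>T>0. \<forall>u \<theta> :: real \<Rightarrow> real \<Rightarrow> real.
    classical_solution \<alpha> n \<kappa> c0 u \<theta> \<and> (\<forall>t\<ge>0. integral {0..1} (\<lambda>x. u x t) = 0) \<longrightarrow>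
      (\<forall>t\<ge>T. energy A u \<theta> t \<le> energy A u \<theta> T) \<and>
      (energy A u \<theta> \<longlongrightarrow> 0) at_top"
proof -
  \<comment> \<open>\<open>A\<close> gives equality in the largeness condition of
    \<open>energy_dissipation\<close>. \<open>T\<close> solves
    \<open>n * \<kappa> * (\<alpha> * T) = A * \<alpha>\<^sup>2\<close>, so the lateness condition
    holds from \<open>T\<close> on. Both are fixed before any solution is chosen.\<close>
  define A where "A = 2 * (n + 1)\<^sup>2 / (n * \<alpha>)"
  define T where "T = A * \<alpha> / (n * \<kappa>)"
  define c where "c = min n \<alpha>"
  have A: "A > 0" and T: "T > 0" and c: "c > 0" and c0: "c0 > 0"
    using assms by (auto simp: A_def T_def c_def add_pos_pos)
  have late: "A * \<alpha>\<^sup>2 * sigma_s \<alpha> c0 t \<le> n * \<kappa>" if "t \<ge> T" for t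
  proof -
    have "n * \<kappa> * (\<alpha> * T) \<le> n * \<kappa> * (\<alpha> * t + c0)"
      using assms that c0 by (intro mult_left_mono) (auto intro: add_increasing2)
    also have "n * \<kappa> * (\<alpha> * T) = A * \<alpha>\<^sup>2"
      using assms by (simp add: T_def power2_eq_square)
    finally show ?thesis
      using assms that T c0 by (simp add: sigma_s_def pos_divide_le_eq add_pos_pos)
  qed
  have "(\<forall>t\<ge>T. energy A u \<theta> t \<le> energy A u \<theta> T) \<and> (energy A u \<theta> \<longlongrightarrow> 0) at_top"
    if sol: "classical_solution \<alpha> n \<kappa> c0 u \<theta>"
      and mean: "\<forall>t\<ge>0. integral {0..1} (\<lambda>x. u x t) = 0" for u \<theta>
  proof -
    \<comment> \<open>\<open>?w\<close> is the integrating factor of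
      \<open>E' \<le> - c * \<sigma> * E\<close>: its logarithmic derivative is
      \<open>c * sigma_s \<alpha> c0 t\<close>.\<close>
    let ?E = "energy A u \<theta>" and ?w = "\<lambda>t. (\<alpha> * t + c0) powr (c / \<alpha>)"
    have C21: "C21 u" "C21 \<theta>" using sol by (auto simp: classical_solution_def)
    have E_nonneg: "?E t \<ge> 0" if "t \<ge> 0" for t
      using energy_eq[OF C21 that, of A] A C21_slices[OF C21(1) that] C21_slices[OF C21(2) that]
      by (auto intro!: add_nonneg_nonneg mult_nonneg_nonneg integral_nonneg
            integrable_continuous_interval continuous_intros)
    have diss: "\<exists>D. (?E has_real_derivative D) (at t) \<and> D \<le> - (c * sigma_s \<alpha> c0 t * ?E t)"
      if "t \<ge> T" for t
      by (rule energy_dissipation[of \<alpha> n \<kappa> A c0 t u \<theta>])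
         (use assms A T c0 sol mean late that in \<open>auto simp: A_def c_def\<close>)
    have lin: "\<alpha> * t + c0 > 0" if "t \<ge> T" for t
      using assms T c0 that by (auto intro!: add_pos_pos)
    have mono: "?E t \<le> ?E T" if "t \<ge> T" for t
    proof (rule DERIV_nonpos_imp_nonincreasing[OF that])
      fix s assume s: "T \<le> s" "s \<le> t"
      have "0 \<le> c * sigma_s \<alpha> c0 s * ?E s"
        using c s T lin[OF s(1)] E_nonneg[of s] by (simp add: sigma_s_def)
      then show "\<exists>y. (?E has_real_derivative y) (at s) \<and> y \<le> 0"
        using diss[OF s(1)] by fastforce
    qed
    have weighted: "?E t * ?w t \<le> ?E T * ?w T" if "t \<ge> T" for t
    proof (rule DERIV_nonpos_imp_nonincreasing[OF that, of "\<lambda>t. ?E t * ?w t"])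
      fix s assume s: "T \<le> s" "s \<le> t"
      obtain D where D: "(?E has_real_derivative D) (at s)" "D \<le> - (c * sigma_s \<alpha> c0 s * ?E s)"
        using diss[OF s(1)] by blast
      have "(?w has_real_derivative c * sigma_s \<alpha> c0 s * ?w s) (at s)"
        using lin[OF s(1)] assms
        by (auto intro!: derivative_eq_intros simp: sigma_s_def powr_diff)
      from DERIV_mult[OF D(1) this] have "((\<lambda>t. ?E t * ?w t) has_real_derivative
        (D + c * sigma_s \<alpha> c0 s * ?E s) * ?w s) (at s)"
        by (simp add: algebra_simps)
      moreover have "(D + c * sigma_s \<alpha> c0 s * ?E s) * ?w s \<le> 0"
        using D(2) by (intro mult_nonpos_nonneg) auto
      ultimately show "\<exists>y. ((\<lambda>t. ?E t * ?w t) has_real_derivative y) (at s) \<and> y \<le> 0" by blast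
    qed
    have "(?E \<longlongrightarrow> 0) at_top"
    proof (rule tendsto_sandwich)
      show "eventually (\<lambda>t. 0 \<le> ?E t) at_top"
        using eventually_ge_at_top[of 0] by eventually_elim (rule E_nonneg)
      show "eventually (\<lambda>t. ?E t \<le> ?E T * ?w T / ?w t) at_top"
        using eventually_ge_at_top[of T]
      proof eventually_elim
        case (elim t)
        then show ?case using weighted[of t] lin[of t] by (simp add: pos_le_divide_eq)
      qed
      \<comment> \<open>The weight is unbounded because its exponent \<open>c / \<alpha>\<close> is
        positive; this expresses the divergence of the time integral of
        \<open>sigma_s\<close>.\<close>
      have "filterlim (\<lambda>t. (\<alpha> * t + c0) powr r) at_top at_top" if "r > 0" for r
        using that assms(1) by real_asymp
      then have "filterlim ?w at_infinity at_top"
        using c assms(1) by (intro filterlim_at_top_imp_at_infinity) simp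
      then show "((\<lambda>t. ?E T * ?w T / ?w t) \<longlongrightarrow> 0) at_top"
        by (rule tendsto_divide_0[OF tendsto_const])
    qed simp
    with mono show ?thesis by blast
  qed
  with A T show ?thesis by blast
qed

end
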